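(* Let $n,k\ge 1$ be integers, let $T$ be a triangulation of $P(n,k)=(\Delta_{n-1})^k$, and let $\ell:V(T)\to[n]^k$ be a factorwise-dual-Sperner labeling of $T$. Then there exist a factorwise-dual-Sperner labeling $\ell':V(T)\to[n]^k$ equivalent to $\ell$ and an elementary simplex $Q$ of $T$ such that the set of labels $\Lambda(Q)=\{\ell'(v)\mid v\in V(Q)\}$ is balanced with respect to $V=V_1\sqcup\dots\sqcup V_k$, where $V_i=[n]$ for all $1\le i\le k$.
   Context: $[n]=\{1,\dots,n\}$; $\Delta_{n-1}=\{y\in\mathbb{R}^n_{\ge 0}:\sum_i y_i=1\}$; for $y\in\Delta_{n-1}$, $\mathrm{supp}(y)=\{i\in[n]: y_i\ne 0\}$. $P(n,k)$ is the Cartesian product of $k$ copies of $\Delta_{n-1}$, a $k(n-1)$-dimensional polytope; its points are written $v=(v_1,\dots,v_k)$ with $v_i\in\Delta_{n-1}$. For a triangulation $T$, $V(T)$ is its set of vertices, its elementary simplices are its simplices of top dimension (here $k(n-1)$), and $V(Q)$ is the vertex set of a simplex $Q$. A function $\ell:V(T)\to[n]^k$, $\ell(v)=(\ell_1(v),\dots,\ell_k(v))$, is a factorwise-dual-Sperner labeling if for every $v\in V(T)$ and every $1\le i\le k$: whenever $[n]\setminus\mathrm{supp}(v_i)\ne\emptyset$, we have $\ell_i(v)\in[n]\setminus\mathrm{supp}(v_i)$. Two factorwise-dual-Sperner labelings $\ell,\ell'$ are equivalent if $\ell_i(v)=\ell'_i(v)$ for all $v\in V(T)$ and $1\le i\le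 k$ with $[n]\setminus\mathrm{supp}(v_i)=\emptyset$. A tuple $(a_1,\dots,a_k)\in[n]^k$ is regarded as the $k$-element subset of $V=V_1\sqcup\dots\sqcup V_k$ containing the element $a_j$ of $V_j$ for each $j$. A set $\Lambda\subseteq[n]^k$ is balanced with respect to $V$ if there is a function $f:\Lambda\to[0,1]$ such that for every $j\in[k]$ and $i\in[n]$, $\sum_{a\in\Lambda:\,a_j=i}f(a)=1$. *)

theory Defs
  imports "HOL-Analysis.Analysis"
begin

text \<open>
  The index sets \<open>[n]\<close> and \<open>[k]\<close> are finite types \<open>'n\<close> and \<open>'k\<close>, so \<open>n = CARD('n) \<ge> 1\<close> and
  \<open>k = CARD('k) \<ge> 1\<close>. A point \<open>v = (v\<^sub>1, \<dots>, v\<^sub>k)\<close> of \<open>P(n,k)\<close> has type \<open>real ^ 'n ^ 'k\<close>, with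
  factors \<open>v $ i\<close>, and a tuple in \<open>[n]\<^sup>k\<close> has type \<open>'n ^ 'k\<close>.
\<close>

definition std_simplex :: "(real ^ 'n) set" where
  "std_simplex = {y. (\<forall>i. 0 \<le> y $ i) \<and> (\<Sum>i\<in>UNIV. y $ i) = 1}"

definition simplex_power :: "(real ^ 'n ^ 'k) set" where
  "simplex_power = {v. \<forall>i. v $ i \<in> std_simplex}"

definition vec_supp :: "real ^ 'n \<Rightarrow> 'n set" where
  "vec_supp y = {i. y $ i \<noteq> 0}"

text \<open>
  The library's \<^const>\<open>triangulation\<close> does not ask for closure under faces, so \<open>T\<close> may consist of all
  simplices of the complex or, for instance, of the maximal ones only. The vertex set and the
  top-dimensional simplices below are the same in either case.
\<close>

definition triangulation_of ::
  "('a::euclidean_space) set set \<Rightarrow> 'a set \<Rightarrow> bool" where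
  "triangulation_of T P \<longleftrightarrow> triangulation T \<and> \<Union>T = P"

definition simplex_vertices :: "('a::euclidean_space) set \<Rightarrow> 'a set" where
  "simplex_vertices Q = {v. v extreme_point_of Q}"

definition triangulation_vertices :: "('a::euclidean_space) set set \<Rightarrow> 'a set" where
  "triangulation_vertices T = (\<Union>Q\<in>T. simplex_vertices Q)"

definition elementary_simplex :: "(real ^ 'n ^ 'k) set set \<Rightarrow> (real ^ 'n ^ 'k) set \<Rightarrow> bool" where
  "elementary_simplex T Q \<longleftrightarrow>
     Q \<in> T \<and> (int CARD('k) * (int CARD('n) - 1)) simplex Q"

text \<open>
  A labeling \<open>V(T) \<rightarrow> [n]\<^sup>k\<close> is represented by a total function; its values outside \<open>V(T)\<close> are
  never consulted.
\<close>

definition factorwise_dual_Sperner ::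
  "(real ^ 'n ^ 'k) set set \<Rightarrow> (real ^ 'n ^ 'k \<Rightarrow> 'n ^ 'k) \<Rightarrow> bool" where
  "factorwise_dual_Sperner T l \<longleftrightarrow>
     (\<forall>v\<in>triangulation_vertices T. \<forall>i.
        UNIV - vec_supp (v $ i) \<noteq> {} \<longrightarrow> l v $ i \<in> UNIV - vec_supp (v $ i))"

definition equivalent_labelings ::
  "(real ^ 'n ^ 'k) set set \<Rightarrow> (real ^ 'n ^ 'k \<Rightarrow> 'n ^ 'k) \<Rightarrow> (real ^ 'n ^ 'k \<Rightarrow> 'n ^ 'k) \<Rightarrow> bool"
where
  "equivalent_labelings T l l' \<longleftrightarrow>
     (\<forall>v\<in>triangulation_vertices T. \<forall>i.
        UNIV - vec_supp (v $ i) = {} \<longrightarrow> l v $ i = l' v $ i)"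

text \<open>
  Balancedness with respect to \<open>V\<^sub>1 \<squnion> \<dots> \<squnion> V\<^sub>k\<close> with every \<open>V\<^sub>j = [n]\<close>: the tuple \<open>a\<close> stands for
  the \<open>k\<close>-element subset containing \<open>a $ j\<close> from the \<open>j\<close>-th copy.
\<close>

definition balanced :: "('n ^ 'k) set \<Rightarrow> bool" where
  "balanced \<Lambda> \<longleftrightarrow>
     (\<exists>f :: 'n ^ 'k \<Rightarrow> real. (\<forall>a\<in>\<Lambda>. f a \<in> {0..1}) \<and>
        (\<forall>j i. (\<Sum>a\<in>{a\<in>\<Lambda>. a $ j = i}. f a) = 1))"

end

theory Submission
  imports Defs
begin

text \<open>
  Write \<open>P\<close> for the product of simplices and \<open>c = 1/n\<close>. Balancedness of the labels of a simplex
  \<open>Q\<close> is a statement about barycenters: extend \<open>v \<mapsto> (e\<^bsub>\<ell>'\<^sub>1(v)\<^esub>, \<dots>, e\<^bsub>\<ell>'\<^sub>k(v)\<^esub>)\<close> from the vertices of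
  the triangulation to a continuous map \<open>F : P \<rightarrow> P\<close> that is affine on every simplex. If
  \<open>x = \<Sum> u v * v\<close> is a convex combination of the vertices of \<open>Q\<close> and all coordinates of \<open>F x\<close> are
  equal to \<open>c\<close>, then giving the label \<open>a\<close> the weight \<open>n\<close> times the sum of \<open>u v\<close> over the
  vertices labelled \<open>a\<close> shows that the labels of \<open>Q\<close> are balanced. So it suffices that
  \<open>F\<close> attains the barycenter, and that a point where it does lies in a simplex of top dimension
  (\<open>triangulation_covered_by_top_dim\<close>; \<open>aff_dim_simplex_power\<close> computes that dimension).

  Whether \<open>F\<close> attains the barycenter depends on the labels at points whose \<open>i\<close>-th factor lies on the
  boundary, and those are exactly the labels that an equivalent labeling may change. On a single
  triangle, the labels 2, 1, 1 at the three corners are admissible but miss 3, while the cyclic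
  labels 2, 3, 1 work. In general, arrange \<open>[n]\<close> in a cycle and label a vertex whose \<open>i\<close>-th support
  \<open>S\<close> is proper by an element outside \<open>S\<close> that directly follows an element of \<open>S\<close>. If
  the \<open>i\<close>-th support \<open>S\<close> of a point \<open>x\<close> is proper, some \<open>j \<in> S\<close> has its predecessor outside \<open>S\<close>. All
  vertices that contribute to \<open>x\<close> have their \<open>i\<close>-th support inside \<open>S\<close>, so none of them has \<open>j\<close>
  as its \<open>i\<close>-th label, and \<open>F x $ i $ j = 0\<close> although \<open>x $ i $ j > 0\<close>.

  This boundary behaviour is what \<open>hits_barycenter\<close> needs. It applies Brouwer's theorem to the map
  that increases \<open>x $ i $ j\<close> by the excess of \<open>F x $ i $ j\<close> over \<open>c\<close> and normalizes each factor. At a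
  fixed point where the \<open>i\<close>-th factor of \<open>F x\<close> is not the barycenter, the \<open>i\<close>-th support of \<open>x\<close>
  would be the set of those \<open>j\<close> with \<open>F x $ i $ j > c\<close>. This set is proper, but \<open>F x $ i\<close> vanishes
  at none of its elements.
\<close>

section \<open>Simplices and triangulations\<close>

text \<open>
  Differences to a fixed point of \<open>C\<close> are linearly independent, so prescribed values on \<open>C\<close> extend to
  an affine map of the whole space, which is continuous.
\<close>

lemma affine_independent_extend:
  fixes g :: "'a::euclidean_space \<Rightarrow> 'b::euclidean_space"
  assumes "\<not> affine_dependent C"
  obtains A where "continuous_on UNIV A"
    and "\<And>u. sum u C = 1 \<Longrightarrow> A (\<Sum>v\<in>C. u v *\<^sub>R v) = (\<Sum>v\<in>C. u v *\<^sub>R g v)"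
proof (cases "C = {}")
  case True
  then show thesis using that[of "\<lambda>_. 0"] by simp
next
  case False
  then obtain a where a: "a \<in> C" by blast
  have "independent ((\<lambda>x. -a + x) ` (C - {a}))"
    using assms a affine_dependent_iff_dependent2 by blast
  from linear_independent_extend[OF this, of "\<lambda>y. g (y + a) - g a"]
  obtain h where h: "linear h"
    and hv: "\<And>v. v \<in> C - {a} \<Longrightarrow> h (-a + v) = g v - g a"
    by auto
  have hC: "h v = h a + (g v - g a)" if "v \<in> C" for v
    using hv[of v] that by (cases "v = a") (auto simp: linear_diff[OF h] algebra_simps)
  show thesis
  proof
    show "continuous_on UNIV (\<lambda>x. h x - h a + g a)"
      by (intro continuous_intros linear_continuous_on linear_conv_bounded_linear[THEN iffD1] h)
    fix u :: "'a \<Rightarrow> real" assume u: "sum u C = 1"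
    have "h (\<Sum>v\<in>C. u v *\<^sub>R v) = (\<Sum>v\<in>C. u v *\<^sub>R h v)"
      by (simp add: linear_sum[OF h] linear_scale[OF h])
    also have "\<dots> = (\<Sum>v\<in>C. u v *\<^sub>R (h a - g a) + u v *\<^sub>R g v)"
      by (intro sum.cong refl) (simp add: hC algebra_simps)
    also have "\<dots> = (h a - g a) + (\<Sum>v\<in>C. u v *\<^sub>R g v)"
      by (simp add: sum.distrib u flip: scaleR_sum_left)
    finally show "h (\<Sum>v\<in>C. u v *\<^sub>R v) - h a + g a = (\<Sum>v\<in>C. u v *\<^sub>R g v)"
      by simp
  qed
qed

lemma simplex_vertices_affine_independent:
  assumes "n simplex Q"
  shows "\<not> affine_dependent (simplex_vertices Q)" "finite (simplex_vertices Q)"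
    "Q = convex hull (simplex_vertices Q)"
proof -
  obtain C where C: "\<not> affine_dependent C" "Q = convex hull C"
    using assms by (auto simp: simplex_def)
  then have "simplex_vertices Q = C"
    by (auto simp: simplex_vertices_def extreme_point_of_convex_hull_affine_independent)
  then show "\<not> affine_dependent (simplex_vertices Q)" "finite (simplex_vertices Q)"
    "Q = convex hull (simplex_vertices Q)"
    using C aff_independent_finite by auto
qed

text \<open>
  The intersection is a common face, and a face is spanned by extreme points that it inherits from
  either simplex. This makes affine extensions on different simplices agree where they overlap.
\<close>

lemma triangulation_Int_convex_hull:
  assumes T: "triangulation T" and Q: "Q \<in> T" "Q' \<in> T"
  shows "Q \<inter> Q' \<subseteq> convex hull (simplex_vertices Q \<inter> simplex_vertices Q')"
proof -
  have face: "Q \<inter> Q' face_of Q" "Q \<inter> Q' face_of Q'"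
    using T Q Int_commute[of Q Q'] unfolding triangulation_def by metis+
  obtain n n' where "n simplex Q" "n' simplex Q'"
    using T Q unfolding triangulation_def by blast
  then have "compact (Q \<inter> Q')" "convex (Q \<inter> Q')"
    by (auto intro: compact_Int compact_simplex convex_Int convex_simplex)
  then have "Q \<inter> Q' = convex hull {x. x extreme_point_of (Q \<inter> Q')}"
    by (rule Krein_Milman_Minkowski)
  also have "\<dots> \<subseteq> convex hull (simplex_vertices Q \<inter> simplex_vertices Q')"
    using extreme_point_of_face[OF face(1)] extreme_point_of_face[OF face(2)]
    by (intro hull_mono) (auto simp: simplex_vertices_def)
  finally show ?thesis .
qed

lemma piecewise_linear_extension:
  fixes g :: "'a::euclidean_space \<Rightarrow> 'b::euclidean_space"
  assumes T: "triangulation T"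
  obtains F where "continuous_on (\<Union>T) F"
    and "\<And>Q u. Q \<in> T \<Longrightarrow> (\<And>v. v \<in> simplex_vertices Q \<Longrightarrow> 0 \<le> u v) \<Longrightarrow>
           sum u (simplex_vertices Q) = 1 \<Longrightarrow>
           F (\<Sum>v\<in>simplex_vertices Q. u v *\<^sub>R v) = (\<Sum>v\<in>simplex_vertices Q. u v *\<^sub>R g v)"
proof -
  have simp: "\<exists>n. n simplex Q" if "Q \<in> T" for Q
    using T that by (auto simp: triangulation_def)
  have "\<exists>A. continuous_on UNIV A \<and> (\<forall>u. sum u (simplex_vertices Q) = 1 \<longrightarrow>
      A (\<Sum>v\<in>simplex_vertices Q. u v *\<^sub>R v) = (\<Sum>v\<in>simplex_vertices Q. u v *\<^sub>R g v))"
    if "Q \<in> T" for Q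
  proof -
    from simp[OF that] obtain n where "n simplex Q" ..
    then show ?thesis
      using affine_independent_extend[OF simplex_vertices_affine_independent(1)] by metis
  qed
  then obtain A where A: "\<And>Q. Q \<in> T \<Longrightarrow> continuous_on UNIV (A Q :: 'a \<Rightarrow> 'b)"
    and Asum: "\<And>Q u. Q \<in> T \<Longrightarrow> sum u (simplex_vertices Q) = 1 \<Longrightarrow>
      A Q (\<Sum>v\<in>simplex_vertices Q. u v *\<^sub>R v) = (\<Sum>v\<in>simplex_vertices Q. u v *\<^sub>R g v)"
    by metis
  have agree: "A Q x = A Q' x" if QQ: "Q \<in> T" "Q' \<in> T" and x: "x \<in> Q" "x \<in> Q'" for Q Q' x
  proof -
    let ?D = "simplex_vertices Q \<inter> simplex_vertices Q'"
    have fin: "finite (simplex_vertices R)" if "R \<in> T" for R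
      using simp that simplex_vertices_affine_independent(2) by blast
    have "x \<in> convex hull ?D"
      using triangulation_Int_convex_hull[OF T QQ] x by blast
    then obtain u where u: "sum u ?D = 1" "x = (\<Sum>v\<in>?D. u v *\<^sub>R v)"
      using fin QQ by (auto simp: convex_hull_finite)
    \<comment> \<open>The coordinates with respect to the common vertices, padded with zeros, are coordinates with
      respect to either simplex.\<close>
    define w where "w = (\<lambda>v. if v \<in> ?D then u v else 0)"
    have "A R x = (\<Sum>v\<in>?D. u v *\<^sub>R g v)" if R: "R \<in> T" and D: "?D \<subseteq> simplex_vertices R" for R
    proof -
      have sums: "(\<Sum>v\<in>simplex_vertices R. w v *\<^sub>R f v) = (\<Sum>v\<in>?D. u v *\<^sub>R f v)"
        for f :: "'a \<Rightarrow> 'c::real_vector"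
        by (rule sum.mono_neutral_cong_right) (use fin[OF R] D in \<open>auto simp: w_def\<close>)
      have "sum w (simplex_vertices R) = 1"
        using sums[of "\<lambda>_. 1::real"] u by simp
      from Asum[OF R this] show ?thesis by (simp add: sums u(2))
    qed
    then show ?thesis using QQ by simp
  qed
  define F where "F x = A (SOME Q. Q \<in> T \<and> x \<in> Q) x" for x
  have F: "F x = A Q x" if "Q \<in> T" "x \<in> Q" for Q x
    using someI[of "\<lambda>Q. Q \<in> T \<and> x \<in> Q" Q] that agree unfolding F_def by blast
  show thesis
  proof
    have "continuous_on (\<Union>Q\<in>T. Q) F"
    proof (rule continuous_on_closed_Union)
      show "finite T" using T by (simp add: triangulation_def)
      fix Q assume Q: "Q \<in> T"
      then show "closed Q" using simp closed_simplex by blast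
      show "continuous_on Q F"
        using continuous_on_subset[OF A[OF Q] subset_UNIV] F[OF Q] by (metis continuous_on_cong)
    qed
    then show "continuous_on (\<Union>T) F" by simp
  next
    fix Q and u :: "'a \<Rightarrow> real"
    assume Q: "Q \<in> T" and u: "\<And>v. v \<in> simplex_vertices Q \<Longrightarrow> 0 \<le> u v"
      "sum u (simplex_vertices Q) = 1"
    obtain n where n: "n simplex Q" using simp[OF Q] by blast
    have "(\<Sum>v\<in>simplex_vertices Q. u v *\<^sub>R v) \<in> convex hull (simplex_vertices Q)"
      using u simplex_vertices_affine_independent(2)[OF n] by (auto simp: convex_hull_finite)
    then show "F (\<Sum>v\<in>simplex_vertices Q. u v *\<^sub>R v) = (\<Sum>v\<in>simplex_vertices Q. u v *\<^sub>R g v)"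
      using F[OF Q] Asum[OF Q u(2)] simplex_vertices_affine_independent(3)[OF n] by simp
  qed
qed

text \<open>
  Removing one closed set of smaller dimension leaves a dense relatively open set with the same affine
  hull, so the removal can be repeated.
\<close>

lemma not_subset_Union_low_dim:
  fixes S :: "'a::euclidean_space set"
  assumes "finite \<Q>" "\<And>Q. Q \<in> \<Q> \<Longrightarrow> closed Q \<and> aff_dim Q < aff_dim S"
    and "openin (top_of_set (affine hull S)) S" "S \<noteq> {}"
  shows "\<not> S \<subseteq> \<Union>\<Q>"
  using assms
proof (induction \<Q> arbitrary: S rule: finite_induct)
  case empty
  then show ?case by simp
next
  case (insert Q \<Q>)
  have "closure (S - Q) = closure S"
    using dense_complement_openin_affine_hull insert.prems by blast
  then have ne: "S - Q \<noteq> {}" using insert.prems(3) by (metis closure_empty closure_eq_empty)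
  have "openin (top_of_set (affine hull S)) (S - Q)"
  proof -
    have "open (- Q)" using insert.prems(1) by auto
    then have "openin (top_of_set (affine hull S)) (S \<inter> - Q)"
      using insert.prems(2) openin_Int_open by blast
    then show ?thesis by (simp add: Diff_eq)
  qed
  moreover from this have "affine hull (S - Q) = affine hull S"
    using affine_hull_openin ne by blast
  moreover from this have "aff_dim (S - Q) = aff_dim S"
    by (rule aff_dim_affine_hull2)
  ultimately have "\<not> S - Q \<subseteq> \<Union>\<Q>"
    using insert.IH[of "S - Q"] insert.prems(1) ne by simp
  then show ?case by auto
qed

text \<open>
  The top-dimensional simplices form a closed set. If it missed a point, it would miss a relatively
  open piece of the polytope, which the finitely many lower-dimensional simplices cannot cover.
\<close>

lemma triangulation_covered_by_top_dim:
  fixes T :: "'a::euclidean_space set set"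
  assumes T: "triangulation T" and conv: "convex (\<Union>T)" and x: "x \<in> \<Union>T"
  obtains Q where "Q \<in> T" "x \<in> Q" "aff_dim Q = aff_dim (\<Union>T)"
proof -
  let ?P = "\<Union>T"
  define U where "U = {Q\<in>T. aff_dim Q = aff_dim ?P}"
  have closed: "closed Q" if "Q \<in> T" for Q
    using T that closed_simplex unfolding triangulation_def by blast
  have fin: "finite T" using T by (simp add: triangulation_def)
  have "x \<in> \<Union>U"
  proof (rule ccontr)
    assume "x \<notin> \<Union>U"
    have "closed (\<Union>U)"
      using fin closed by (auto simp: U_def)
    then have op: "open (- \<Union>U)" by auto
    define S where "S = rel_interior ?P \<inter> - \<Union>U"
    have "x \<in> closure (rel_interior ?P)"
      unfolding convex_closure_rel_interior[OF conv] using x by (rule subsetD[OF closure_subset])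
    then have ne: "S \<noteq> {}"
      using op \<open>x \<notin> \<Union>U\<close> open_Int_closure_eq_empty[OF op, of "rel_interior ?P"]
      unfolding S_def by blast
    have ope: "openin (top_of_set (affine hull ?P)) S"
      unfolding S_def using openin_rel_interior op by (rule openin_Int_open)
    then have hull: "affine hull S = affine hull ?P"
      using ne affine_hull_openin by blast
    then have dim: "aff_dim S = aff_dim ?P" by (rule aff_dim_affine_hull2)
    have "\<not> S \<subseteq> \<Union>(T - U)"
    proof (rule not_subset_Union_low_dim)
      fix Q assume "Q \<in> T - U"
      then show "closed Q \<and> aff_dim Q < aff_dim S"
        using closed aff_dim_subset[of Q ?P] by (auto simp: U_def dim less_le)
    qed (use fin ope ne hull in auto)
    moreover have "S \<subseteq> \<Union>(T - U)"
      using rel_interior_subset[of ?P] by (auto simp: S_def)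
    ultimately show False by blast
  qed
  then show thesis using that by (auto simp: U_def)
qed

section \<open>The product of simplices\<close>

lemma mem_simplex_power:
  "x \<in> simplex_power \<longleftrightarrow> (\<forall>i j. 0 \<le> x $ i $ j) \<and> (\<forall>i. (\<Sum>j\<in>UNIV. x $ i $ j) = 1)"
  by (auto simp: simplex_power_def std_simplex_def)

lemma vec_supp_nonempty:
  assumes "x \<in> simplex_power"
  shows "vec_supp (x $ i) \<noteq> {}"
proof
  assume "vec_supp (x $ i) = {}"
  then have "(\<Sum>j\<in>UNIV. x $ i $ j) = 0" by (simp add: vec_supp_def)
  then show False using assms by (simp add: mem_simplex_power)
qed

text \<open>
  Coordinates are nonnegative, so nothing cancels in a convex combination.
\<close>

lemma vec_supp_convex_combination:
  assumes x: "x = (\<Sum>v\<in>V. u v *\<^sub>R v)" and V: "finite V" "V \<subseteq> simplex_power"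
    and u: "\<And>v. v \<in> V \<Longrightarrow> 0 \<le> u v" and v: "v \<in> V" "u v \<noteq> 0"
  shows "vec_supp (v $ i) \<subseteq> vec_supp (x $ i)"
proof
  fix j assume "j \<in> vec_supp (v $ i)"
  then have "0 < u v * v $ i $ j"
    using u[OF v(1)] v V by (auto simp: vec_supp_def mem_simplex_power less_le subset_iff)
  also have "\<dots> \<le> (\<Sum>w\<in>V. u w * w $ i $ j)"
    using u V v by (intro member_le_sum) (auto simp: mem_simplex_power subset_iff)
  also have "\<dots> = x $ i $ j" by (simp add: x)
  finally show "j \<in> vec_supp (x $ i)" by (simp add: vec_supp_def)
qed

lemma convex_simplex_power: "convex simplex_power"
  unfolding convex_def
  by (auto simp: mem_simplex_power sum.distrib simp flip: sum_distrib_left)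

lemma compact_simplex_power: "compact (simplex_power :: (real ^ 'n::finite ^ 'k::finite) set)"
proof -
  have "simplex_power = (\<Inter>i. \<Inter>j. {x :: real ^ 'n ^ 'k. 0 \<le> x $ i $ j})
      \<inter> (\<Inter>i. {x. (\<Sum>j\<in>UNIV. x $ i $ j) = 1})"
    by (auto simp: mem_simplex_power)
  also have "closed \<dots>"
    by (intro closed_Int closed_INT ballI closed_Collect_le closed_Collect_eq continuous_intros)
  finally have "closed (simplex_power :: (real ^ 'n ^ 'k) set)" .
  moreover have "bounded (simplex_power :: (real ^ 'n ^ 'k) set)"
  proof (rule boundedI)
    fix x :: "real ^ 'n ^ 'k" assume x: "x \<in> simplex_power"
    have "norm x \<le> (\<Sum>i\<in>UNIV. norm (x $ i))"
      by (simp add: norm_vec_def L2_set_le_sum)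
    also have "\<dots> \<le> (\<Sum>i\<in>(UNIV :: 'k set). 1)"
    proof (rule sum_mono)
      fix i
      have "norm (x $ i) \<le> (\<Sum>j\<in>UNIV. \<bar>x $ i $ j\<bar>)" by (rule norm_le_l1_cart)
      also have "\<dots> = 1" using x by (simp add: mem_simplex_power)
      finally show "norm (x $ i) \<le> 1" .
    qed
    finally show "norm x \<le> (\<Sum>i\<in>(UNIV :: 'k set). 1)" .
  qed
  ultimately show ?thesis by (simp add: compact_eq_bounded_closed)
qed

text \<open>
  The affine hull is cut out by the \<open>k\<close> equations saying that each factor has coordinate sum 1. Their
  normal vectors are pairwise orthogonal, and the strictly positive points are relatively open in
  the solution space.
\<close>

lemma aff_dim_simplex_power:
  "aff_dim (simplex_power :: (real ^ 'n::finite ^ 'k::finite) set)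
     = int CARD('k) * (int CARD('n) - 1)"
proof -
  define B :: "(real ^ 'n ^ 'k) set" where "B = {y. \<forall>i. (\<Sum>j\<in>UNIV. y $ i $ j) = 0}"
  define L :: "(real ^ 'n ^ 'k) set" where "L = {y. \<forall>i. (\<Sum>j\<in>UNIV. y $ i $ j) = 1}"
  define c :: "real ^ 'n ^ 'k" where "c = (\<chi> i j. 1 / CARD('n))"
  define N :: "(real ^ 'n ^ 'k) set" where "N = range (\<lambda>i. axis i (\<chi> j. 1))"
  have subB: "subspace B"
    by (auto simp: subspace_def B_def sum.distrib simp flip: sum_distrib_left)
  have ortho: "axis i (\<chi> j. 1) \<bullet> y = (\<Sum>j\<in>UNIV. y $ i $ j)" for i and y :: "real ^ 'n ^ 'k"
    by (simp add: inner_axis' inner_vec_def[of "_ :: real ^ 'n"])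
  have "pairwise orthogonal N"
    by (auto simp: pairwise_def N_def orthogonal_def inner_axis_axis)
  moreover have inj: "inj (\<lambda>i. axis i (\<chi> j. 1) :: real ^ 'n ^ 'k)"
  proof (rule injI)
    fix i i' assume eq: "(axis i (\<chi> j. 1) :: real ^ 'n ^ 'k) = axis i' (\<chi> j. 1)"
    have "((\<chi> j. 1) :: real ^ 'n) \<noteq> 0" by (simp add: vec_eq_iff)
    then show "i = i'" using eq by (simp add: axis_eq_axis)
  qed
  moreover have "0 \<notin> N"
  proof
    assume "0 \<in> N"
    then obtain i where "axis i (\<chi> j. 1) = (0 :: real ^ 'n ^ 'k)" by (auto simp: N_def)
    then have "((\<chi> j. 1) :: real ^ 'n) = 0" by (simp add: axis_eq_0_iff)
    then show False by (simp add: vec_eq_iff)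
  qed
  ultimately have "dim N = card N" 
    using pairwise_orthogonal_independent dim_eq_card_independent by blast
  also have "card N = CARD('k)" unfolding N_def using card_image[OF inj] by simp
  finally have "dim (span N) = CARD('k)" by simp
  moreover have "{y \<in> UNIV. \<forall>x\<in>span N. orthogonal x y} = B"
  proof -
    have "(\<forall>x\<in>span N. orthogonal x y) \<longleftrightarrow> (\<forall>x\<in>N. orthogonal x y)" for y
      using orthogonal_to_span[of _ N y] span_base[of _ N] orthogonal_commute[of y] by blast
    then show ?thesis by (auto simp: N_def B_def orthogonal_def ortho)
  qed
  ultimately have "dim B + CARD('k) = CARD('k) * CARD('n)"
    using dim_subspace_orthogonal_to_vectors[of "span N" UNIV] by simp
  then have "int (dim B) = int CARD('k) * (int CARD('n) - 1)"
    by (simp add: algebra_simps flip: of_nat_mult of_nat_add)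
  moreover have "L = (+) c ` B"
  proof (rule set_eqI)
    fix y
    have "y \<in> L \<longleftrightarrow> y - c \<in> B"
      by (simp add: L_def B_def c_def sum_subtractf)
    also have "\<dots> \<longleftrightarrow> y \<in> (+) c ` B" by (force simp: image_iff intro: bexI[of _ "y - c"])
    finally show "y \<in> L \<longleftrightarrow> y \<in> (+) c ` B" .
  qed
  then have "aff_dim L = int (dim B)" and affL: "affine L"
    using subB by (simp_all add: aff_dim_translation_eq aff_dim_subspace
        subspace_imp_affine flip: affine_translation)
  moreover have "aff_dim (simplex_power :: (real ^ 'n ^ 'k) set) = aff_dim L"
  proof (rule antisym)
    show "aff_dim (simplex_power :: (real ^ 'n ^ 'k) set) \<le> aff_dim L"
      by (rule aff_dim_subset) (auto simp: L_def mem_simplex_power)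
    define U :: "(real ^ 'n ^ 'k) set" where "U = {y. \<forall>i j. 0 < y $ i $ j}"
    have "U = (\<Inter>i. \<Inter>j. {y. 0 < y $ i $ j})" by (auto simp: U_def)
    also have "open \<dots>"
      by (intro open_INT ballI finite open_Collect_less continuous_intros)
    finally have "open U" .
    moreover have "c \<in> L \<inter> U" by (simp add: c_def L_def U_def)
    ultimately have "affine hull (L \<inter> U) = affine hull L"
      using affine_hull_convex_Int_open[of L U] affL affine_imp_convex by blast
    then have "aff_dim L = aff_dim (L \<inter> U)" using aff_dim_affine_hull2 by metis
    also have "\<dots> \<le> aff_dim (simplex_power :: (real ^ 'n ^ 'k) set)"
      by (rule aff_dim_subset) (auto simp: L_def U_def mem_simplex_power less_imp_le)
    finally show "aff_dim L \<le> aff_dim (simplex_power :: (real ^ 'n ^ 'k) set)" .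
  qed
  ultimately show ?thesis by simp
qed


section \<open>Maps that attain the barycenter\<close>

text \<open>
  The boundary condition excludes points at which, in some factor, \<open>F x\<close> exceeds the barycenter
  exactly on the support of \<open>x\<close>. Truncating the excess at 0 and normalizing factor by factor gives a
  self-map whose fixed points are of that kind unless \<open>F x\<close> is the barycenter.
\<close>

lemma hits_barycenter:
  fixes F :: "real ^ 'n::finite ^ 'k::finite \<Rightarrow> real ^ 'n ^ 'k"
  assumes cont: "continuous_on simplex_power F"
    and range: "\<And>x. x \<in> simplex_power \<Longrightarrow> F x \<in> simplex_power"
    and boundary: "\<And>x i. x \<in> simplex_power \<Longrightarrow> vec_supp (x $ i) \<noteq> UNIV \<Longrightarrow>
      \<exists>j\<in>vec_supp (x $ i). F x $ i $ j \<le> 1 / CARD('n)"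
  shows "\<exists>x\<in>simplex_power. \<forall>i j. F x $ i $ j = 1 / CARD('n)"
proof -
  define c :: real where "c = 1 / CARD('n)"
  define m where "m x i j = max 0 (F x $ i $ j - c)" for x i j
  define s where "s x i = (\<Sum>j\<in>UNIV. m x i j)" for x i
  define h where "h x = (\<chi> i j. (x $ i $ j + m x i j) / (1 + s x i))" for x
  have m0: "0 \<le> m x i j" for x i j by (simp add: m_def)
  have s0: "0 \<le> s x i" for x i by (simp add: s_def m0 sum_nonneg)
  have s1: "0 < 1 + s x i" for x i using s0[of x i] by linarith
  have "continuous_on simplex_power h"
  proof -
    have "continuous_on simplex_power (\<lambda>x. m x i j)" for i j
      unfolding m_def by (intro continuous_intros cont)
    moreover from this have "continuous_on simplex_power (\<lambda>x. 1 + s x i)" for i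
      unfolding s_def by (intro continuous_intros)
    moreover have "1 + s x i \<noteq> 0" for x i using s1[of x i] by linarith
    ultimately show ?thesis
      unfolding h_def
      by (intro continuous_on_vec_lambda continuous_on_divide) (auto intro!: continuous_intros)
  qed
  moreover have "h ` simplex_power \<subseteq> simplex_power"
  proof clarify
    fix x :: "real ^ 'n ^ 'k" assume x: "x \<in> simplex_power"
    have "(\<Sum>j\<in>UNIV. h x $ i $ j) = 1" for i
    proof -
      have "(\<Sum>j\<in>UNIV. h x $ i $ j) = (\<Sum>j\<in>UNIV. x $ i $ j + m x i j) / (1 + s x i)"
        by (simp add: h_def sum_divide_distrib)
      also have "\<dots> = 1"
        using x s1[of x i] by (simp add: sum.distrib mem_simplex_power s_def)
      finally show ?thesis .
    qed
    then show "h x \<in> simplex_power"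
      using x s1 m0 by (auto simp: mem_simplex_power h_def intro!: divide_nonneg_pos add_nonneg_nonneg)
  qed
  moreover have "(\<chi> i j. 1 / CARD('n)) \<in> (simplex_power :: (real ^ 'n ^ 'k) set)"
    by (simp add: mem_simplex_power)
  ultimately obtain x where x: "x \<in> simplex_power" "h x = x"
    using brouwer[OF compact_simplex_power convex_simplex_power] by blast
  have fixed: "x $ i $ j * s x i = m x i j" for i j
  proof -
    have "x $ i $ j = (x $ i $ j + m x i j) / (1 + s x i)"
      using x(2) by (simp add: h_def vec_eq_iff)
    then show ?thesis using s1[of x i] by (simp add: field_simps)
  qed
  have sumF: "(\<Sum>j\<in>UNIV. c - F x $ i $ j) = 0" for i
    using range[OF x(1)] by (simp add: mem_simplex_power sum_subtractf c_def)
  \<comment> \<open>Each factor of \<open>F x\<close> has the same coordinate sum as the barycenter, so it is enough that no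
    coordinate exceeds \<open>c\<close>.\<close>
  have le: "F x $ i $ j \<le> c" for i j
  proof (rule ccontr)
    assume gt: "\<not> F x $ i $ j \<le> c"
    then have "m x i j > 0" by (simp add: m_def)
    then have pos: "s x i > 0" using fixed[of i j] s0[of x i] by (cases "s x i = 0") auto
    have supp: "j' \<in> vec_supp (x $ i) \<longleftrightarrow> c < F x $ i $ j'" for j'
    proof -
      have "0 < x $ i $ j' \<longleftrightarrow> 0 < m x i j'"
        using fixed[of i j', symmetric] pos by (simp add: zero_less_mult_iff)
      moreover have "x $ i $ j' \<noteq> 0 \<longleftrightarrow> 0 < x $ i $ j'"
        using x(1) by (auto simp: mem_simplex_power less_le)
      ultimately show ?thesis by (simp add: vec_supp_def m_def less_max_iff_disj)
    qed
    have "vec_supp (x $ i) \<noteq> UNIV"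
    proof
      assume "vec_supp (x $ i) = UNIV"
      then have "(\<Sum>j\<in>UNIV. c - F x $ i $ j) < (\<Sum>j\<in>(UNIV::'n set). 0)"
        using supp by (intro sum_strict_mono) auto
      then show False using sumF[of i] by simp
    qed
    from boundary[OF x(1) this] show False
      using supp by (auto simp: c_def not_less)
  qed
  have "F x $ i $ j = c" for i j
    using sum_nonneg_eq_0_iff[of UNIV "\<lambda>j. c - F x $ i $ j"] sumF[of i] le by auto
  then show ?thesis using x(1) by (auto simp: c_def)
qed

section \<open>Cyclic labels for proper supports\<close>

text \<open>
  A cyclic permutation of all of \<open>'n\<close>, characterized by having no proper nonempty invariant set.
\<close>

lemma exists_cyclic_function:
  obtains \<sigma> :: "'n::finite \<Rightarrow> 'n"
  where "\<And>S. S \<noteq> {} \<Longrightarrow> \<sigma> ` S \<subseteq> S \<Longrightarrow> S = UNIV"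
proof -
  define N where "N = CARD('n)"
  have N: "0 < N" by (simp add: N_def)
  obtain h :: "'n \<Rightarrow> nat" where h: "bij_betw h UNIV {0..<N}"
    using ex_bij_betw_finite_nat[of "UNIV :: 'n set"] by (auto simp: N_def)
  define r where "r = inv_into UNIV h"
  have hr: "h (r m) = m" if "m < N" for m
    using bij_betw_inv_into_right[OF h] that by (simp add: r_def)
  have rh: "r (h i) = i" for i
    using bij_betw_inv_into_left[OF h] by (simp add: r_def)
  have hN: "h i < N" for i
    using bij_betwE[OF h] by auto
  define \<sigma> where "\<sigma> i = r (Suc (h i) mod N)" for i
  show thesis
  proof
    fix S :: "'n set" assume "S \<noteq> {}" and inv: "\<sigma> ` S \<subseteq> S"
    then obtain i where i: "i \<in> S" by blast
    have orbit: "r ((h i + m) mod N) \<in> S" for m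
    proof (induction m)
      case 0
      then show ?case using i rh hN by simp
    next
      case (Suc m)
      have "\<sigma> (r ((h i + m) mod N)) = r ((h i + Suc m) mod N)"
        using N by (simp add: \<sigma>_def hr mod_Suc_eq)
      then show ?case using Suc inv by force
    qed
    have "j \<in> S" for j
    proof -
      have "(h i + (N - h i + h j)) mod N = h j"
        using hN[of i] hN[of j] by (simp add: less_imp_le)
      then show ?thesis using orbit[of "N - h i + h j"] by (simp add: rh)
    qed
    then show "S = UNIV" by blast
  qed
qed

text \<open>
  \<open>g S\<close> is a successor, outside \<open>S\<close>, of an element of \<open>S\<close>. An element of \<open>S\<close> that is not
  a successor of an element of \<open>S\<close> is then missed by \<open>g\<close> on all subsets of \<open>S\<close>.
\<close>

lemma exists_cyclic_choice:
  obtains g :: "'n::finite set \<Rightarrow> 'n"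
  where "\<And>S. S \<noteq> {} \<Longrightarrow> S \<noteq> UNIV \<Longrightarrow> g S \<notin> S"
    and "\<And>S. S \<noteq> {} \<Longrightarrow> S \<noteq> UNIV \<Longrightarrow> \<exists>j\<in>S. \<forall>R. R \<noteq> {} \<longrightarrow> R \<subseteq> S \<longrightarrow> g R \<noteq> j"
proof -
  obtain \<sigma> :: "'n \<Rightarrow> 'n" where \<sigma>: "\<And>S. S \<noteq> {} \<Longrightarrow> \<sigma> ` S \<subseteq> S \<Longrightarrow> S = UNIV"
    using exists_cyclic_function by metis
  have "\<exists>i. i \<in> \<sigma> ` S - S" if "S \<noteq> {}" "S \<noteq> UNIV" for S
    using \<sigma>[of S] that by blast
  then obtain g where g: "\<And>S. S \<noteq> {} \<Longrightarrow> S \<noteq> UNIV \<Longrightarrow> g S \<in> \<sigma> ` S - S" by metis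
  show thesis
  proof
    fix S :: "'n set" assume S: "S \<noteq> {}" "S \<noteq> UNIV"
    then show "g S \<notin> S" using g by blast
    have "\<not> S \<subseteq> \<sigma> ` S"
    proof
      assume "S \<subseteq> \<sigma> ` S"
      then have "S = \<sigma> ` S" by (intro card_seteq) (auto intro: card_image_le)
      then show False using \<sigma>[of S] S by simp
    qed
    then obtain j where j: "j \<in> S" "j \<notin> \<sigma> ` S" by blast
    have "g R \<noteq> j" if "R \<noteq> {}" "R \<subseteq> S" for R
      using g[of R] that j S by blast
    then show "\<exists>j\<in>S. \<forall>R. R \<noteq> {} \<longrightarrow> R \<subseteq> S \<longrightarrow> g R \<noteq> j" using j by blast
  qed
qed

theorem theorem1p4:
  fixes T :: "(real ^ 'n::finite ^ 'k::finite) set set"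
    and l :: "real ^ 'n ^ 'k \<Rightarrow> 'n ^ 'k"
  assumes "triangulation_of T simplex_power"
    and "factorwise_dual_Sperner T l"
  shows "\<exists>l' Q. factorwise_dual_Sperner T l' \<and> equivalent_labelings T l l' \<and>
           elementary_simplex T Q \<and> balanced (l' ` simplex_vertices Q)"
proof -
  have T: "triangulation T" and UT: "\<Union>T = simplex_power"
    using assms(1) by (auto simp: triangulation_of_def)
  obtain g :: "'n set \<Rightarrow> 'n"
    where g: "\<And>S. S \<noteq> {} \<Longrightarrow> S \<noteq> UNIV \<Longrightarrow> g S \<notin> S"
      and g_miss: "\<And>S. S \<noteq> {} \<Longrightarrow> S \<noteq> UNIV \<Longrightarrow> \<exists>j\<in>S. \<forall>R. R \<noteq> {} \<longrightarrow> R \<subseteq> S \<longrightarrow> g R \<noteq> j"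
    using exists_cyclic_choice by metis
  define l' where
    "l' v = (\<chi> i. if vec_supp (v $ i) = UNIV then l v $ i else g (vec_supp (v $ i)))" for v
  have vertex: "v \<in> simplex_power" if "v \<in> simplex_vertices Q" "Q \<in> T" for v Q
    using that UT by (auto simp: simplex_vertices_def extreme_point_of_def)
  have fin: "finite (simplex_vertices Q)" and hull: "Q = convex hull simplex_vertices Q"
    if "Q \<in> T" for Q
  proof -
    from T that obtain m where "m simplex Q" unfolding triangulation_def by blast
    then show "finite (simplex_vertices Q)" "Q = convex hull simplex_vertices Q"
      by (rule simplex_vertices_affine_independent)+
  qed
  have "factorwise_dual_Sperner T l'"
    unfolding factorwise_dual_Sperner_def
  proof (intro ballI allI impI)
    fix v i assume "v \<in> triangulation_vertices T" and proper: "UNIV - vec_supp (v $ i) \<noteq> {}"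
    then have "v \<in> simplex_power"
      using vertex by (auto simp: triangulation_vertices_def)
    then have "g (vec_supp (v $ i)) \<notin> vec_supp (v $ i)"
      using g vec_supp_nonempty proper by blast
    then show "l' v $ i \<in> UNIV - vec_supp (v $ i)"
      using proper by (auto simp: l'_def)
  qed
  moreover have "equivalent_labelings T l l'"
    by (auto simp: equivalent_labelings_def l'_def)
  moreover
  define e :: "real ^ 'n ^ 'k \<Rightarrow> real ^ 'n ^ 'k" where "e v = (\<chi> i. axis (l' v $ i) 1)" for v
  obtain F where contF: "continuous_on (\<Union>T) F"
    and F: "\<And>Q u. Q \<in> T \<Longrightarrow> (\<And>v. v \<in> simplex_vertices Q \<Longrightarrow> 0 \<le> u v) \<Longrightarrow>
      sum u (simplex_vertices Q) = 1 \<Longrightarrow>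
      F (\<Sum>v\<in>simplex_vertices Q. u v *\<^sub>R v) = (\<Sum>v\<in>simplex_vertices Q. u v *\<^sub>R e v)"
    using piecewise_linear_extension[OF T, of e] by blast
  have e: "e v $ i $ j = (if l' v $ i = j then 1 else 0)" for v i j
    by (simp add: e_def axis_def)
  \<comment> \<open>In barycentric coordinates, \<open>F x $ i $ j\<close> is the total weight of the vertices whose \<open>i\<close>-th label
    is \<open>j\<close>.\<close>
  have coords: "\<exists>u. (\<forall>v\<in>simplex_vertices Q. 0 \<le> u v) \<and> sum u (simplex_vertices Q) = 1 \<and>
      x = (\<Sum>v\<in>simplex_vertices Q. u v *\<^sub>R v) \<and>
      (\<forall>i j. F x $ i $ j = (\<Sum>v\<in>{v\<in>simplex_vertices Q. l' v $ i = j}. u v))"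
    if Q: "Q \<in> T" and x: "x \<in> Q" for Q x
  proof -
    have "x \<in> convex hull simplex_vertices Q" using x hull[OF Q] by simp
    then obtain u where u: "\<And>v. v \<in> simplex_vertices Q \<Longrightarrow> 0 \<le> u v"
      "sum u (simplex_vertices Q) = 1" "x = (\<Sum>v\<in>simplex_vertices Q. u v *\<^sub>R v)"
      using fin[OF Q] by (auto simp: convex_hull_finite)
    have "F x = (\<Sum>v\<in>simplex_vertices Q. u v *\<^sub>R e v)"
      unfolding u(3) using u by (intro F[OF Q]) auto
    then have "F x $ i $ j = (\<Sum>v\<in>{v\<in>simplex_vertices Q. l' v $ i = j}. u v)" for i j
      by (simp add: e if_distrib sum.inter_filter[OF fin[OF Q]] cong: if_cong)
    then show ?thesis using u by blast
  qed
  have "\<exists>x\<in>simplex_power. \<forall>i j. F x $ i $ j = 1 / CARD('n)"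
  proof (rule hits_barycenter[of F])
    show "continuous_on simplex_power F" using contF UT by simp
  next
    fix x :: "real ^ 'n ^ 'k" assume x: "x \<in> simplex_power"
    then obtain Q where Q: "Q \<in> T" "x \<in> Q" using UT by blast
    from coords[OF Q] obtain u where u: "\<forall>v\<in>simplex_vertices Q. 0 \<le> u v"
      "sum u (simplex_vertices Q) = 1" "x = (\<Sum>v\<in>simplex_vertices Q. u v *\<^sub>R v)"
      "\<And>i j. F x $ i $ j = (\<Sum>v\<in>{v\<in>simplex_vertices Q. l' v $ i = j}. u v)" by blast
    have "(\<Sum>j\<in>UNIV. F x $ i $ j) = 1" for i
      using sum.group[OF fin[OF Q(1)], of UNIV "\<lambda>v. l' v $ i" u] u(2,4) by simp
    then show "F x \<in> simplex_power"
      using u(1,4) by (auto simp: mem_simplex_power intro!: sum_nonneg)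
    fix i assume "vec_supp (x $ i) \<noteq> UNIV"
    then obtain j where j: "j \<in> vec_supp (x $ i)"
      and miss: "\<And>R. R \<noteq> {} \<Longrightarrow> R \<subseteq> vec_supp (x $ i) \<Longrightarrow> g R \<noteq> j"
      using g_miss vec_supp_nonempty[OF x] by metis
    have "u v = 0" if v: "v \<in> simplex_vertices Q" "l' v $ i = j" for v
    proof (rule ccontr)
      assume "u v \<noteq> 0"
      then have sub: "vec_supp (v $ i) \<subseteq> vec_supp (x $ i)"
        using vec_supp_convex_combination[OF u(3) fin[OF Q(1)]] vertex Q(1) u(1) v(1) by blast
      then have "l' v $ i = g (vec_supp (v $ i))"
        using \<open>vec_supp (x $ i) \<noteq> UNIV\<close> by (auto simp: l'_def)
      then show False
        using miss[OF vec_supp_nonempty[OF vertex[OF v(1) Q(1)]] sub] v(2) by simp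
    qed
    then have "F x $ i $ j = 0" by (simp add: u(4))
    then show "\<exists>j\<in>vec_supp (x $ i). F x $ i $ j \<le> 1 / CARD('n)"
      using j by (intro bexI[of _ j]) auto
  qed
  then obtain x where x: "x \<in> simplex_power" "\<And>i j. F x $ i $ j = 1 / CARD('n)"
    by blast
  obtain Q where Q: "Q \<in> T" "x \<in> Q" and dim: "aff_dim Q = aff_dim (\<Union>T)"
    using triangulation_covered_by_top_dim[OF T, of x] convex_simplex_power x(1) UT by auto
  obtain m where m: "m simplex Q" using T Q by (auto simp: triangulation_def)
  then have "m = int CARD('k) * (int CARD('n) - 1)"
    using dim UT aff_dim_simplex aff_dim_simplex_power by metis
  then have "elementary_simplex T Q" using m Q by (simp add: elementary_simplex_def)
  moreover have "balanced (l' ` simplex_vertices Q)"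
  proof -
    let ?V = "simplex_vertices Q"
    from coords[OF Q] obtain u where u: "\<forall>v\<in>?V. 0 \<le> u v"
      "\<And>i j. F x $ i $ j = (\<Sum>v\<in>{v\<in>?V. l' v $ i = j}. u v)" by blast
    define f where "f a = CARD('n) * (\<Sum>v\<in>{v\<in>?V. l' v = a}. u v)" for a
    have f0: "0 \<le> f a" for a
      using u(1) by (auto simp: f_def intro!: mult_nonneg_nonneg sum_nonneg)
    have one: "(\<Sum>a\<in>{a\<in>l' ` ?V. a $ j = i}. f a) = 1" for j i
    proof -
      let ?W = "{v\<in>?V. l' v $ j = i}"
      have "(\<Sum>a\<in>{a\<in>l' ` ?V. a $ j = i}. f a)
          = CARD('n) * (\<Sum>a\<in>{a\<in>l' ` ?V. a $ j = i}. \<Sum>v\<in>{v\<in>?W. l' v = a}. u v)"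
        unfolding f_def sum_distrib_left[symmetric]
        by (intro arg_cong2[where f = "(*)"] sum.cong) auto
      also have "(\<Sum>a\<in>{a\<in>l' ` ?V. a $ j = i}. \<Sum>v\<in>{v\<in>?W. l' v = a}. u v) = (\<Sum>v\<in>?W. u v)"
        using fin[OF Q(1)] by (intro sum.group) auto
      also have "\<dots> = 1 / CARD('n)" using u(2) x(2) by simp
      finally show ?thesis by simp
    qed
    have "f a \<le> 1" if "a \<in> l' ` ?V" for a
    proof -
      \<comment> \<open>Any factor bounds \<open>f a\<close>: the labels sharing its \<open>j\<close>-th entry have total weight 1.\<close>
      fix j :: 'k
      have "f a \<le> (\<Sum>b\<in>{b\<in>l' ` ?V. b $ j = a $ j}. f b)"
        using that f0 fin[OF Q(1)] by (intro member_le_sum) auto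
      then show ?thesis using one by simp
    qed
    then show ?thesis unfolding balanced_def using f0 one by (intro exI[of _ f]) auto
  qed
  ultimately show ?thesis by blast
qed

end
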